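(* Let $p,q$ be distinct primes and write $\Phi_{pq}(z)=\sum_{k=0}^{\varphi(pq)}a_{pq}(k)z^{\varphi(pq)-k}$. Then for every $k\in\{0,1,\ldots,\varphi(pq)\}$, $$a_{pq}(k)=\mathcal H_k(1,\zeta_p,\ldots,\zeta_p^{p-1},\zeta_q,\ldots,\zeta_q^{q-1})\in\{-1,0,1\}.$$
   Context: $\zeta_n=e^{2\pi i/n}$; $\Phi_n(z)=\prod_{1\le j\le n,\ (j,n)=1}(z-\zeta_n^j)$ is the $n$th cyclotomic polynomial and $\varphi$ is Euler's totient function. For $r\in\mathbb N_0$, $\mathcal H_r(z_1,\ldots,z_n)=\sum_{r_1+\cdots+r_n=r,\ r_i\in\mathbb N_0}z_1^{r_1}\cdots z_n^{r_n}$ is the complete homogeneous symmetric polynomial of degree $r$ (with $\mathcal H_0=1$); here it is evaluated at the $p+q-1$ arguments $1,\zeta_p,\ldots,\zeta_p^{p-1},\zeta_q,\ldots,\zeta_q^{q-1}$. *)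

theory Defs
  imports Complex_Main "HOL-Computational_Algebra.Computational_Algebra"
    "HOL-Number_Theory.Totient"
begin

definition zeta :: "nat \<Rightarrow> complex" where
  "zeta n = exp (2 * of_real pi * \<i> / of_nat n)"

definition cyclotomic :: "nat \<Rightarrow> complex poly" where
  "cyclotomic n = (\<Prod>j | 1 \<le> j \<and> j \<le> n \<and> coprime j n. [:- (zeta n ^ j), 1:])"

text \<open>Coefficients are numbered from the leading one downwards.\<close>

definition cyclotomic_coeff :: "nat \<Rightarrow> nat \<Rightarrow> complex" where
  "cyclotomic_coeff n k = coeff (cyclotomic n) (totient n - k)"

text \<open>The list \<open>rs\<close> is the exponent vector $(r_1,\ldots,r_n)$ for the
  arguments \<open>zs\<close>, where $n$ is the length of \<open>zs\<close>.\<close>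

definition complete_homogeneous :: "nat \<Rightarrow> 'a :: comm_semiring_1 list \<Rightarrow> 'a" where
  "complete_homogeneous r zs =
     (\<Sum>rs | length rs = length zs \<and> sum_list rs = r. \<Prod>i<length zs. zs ! i ^ (rs ! i))"

lemma degree_cyclotomic: "degree (cyclotomic n) = totient n"
proof -
  have "{j. 1 \<le> j \<and> j \<le> n \<and> coprime j n} = totatives n"
    by (auto simp: totatives_def)
  then show ?thesis
    unfolding cyclotomic_def totient_def by (subst degree_prod_eq_sum_degree) auto
qed

lemma cyclotomic_expansion:
  "poly (cyclotomic n) z = (\<Sum>k=0..totient n. cyclotomic_coeff n k * z ^ (totient n - k))"
proof -
  have "poly (cyclotomic n) z = (\<Sum>i\<le>totient n. coeff (cyclotomic n) i * z ^ i)"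
    by (simp add: poly_altdef degree_cyclotomic)
  also have "\<dots> = (\<Sum>k=0..totient n. cyclotomic_coeff n k * z ^ (totient n - k))"
    unfolding cyclotomic_coeff_def
    by (rule sum.reindex_bij_witness[of _ "\<lambda>k. totient n - k" "\<lambda>k. totient n - k"]) auto
  finally show ?thesis .
qed

text \<open>The index set in the definition of \<^const>\<open>complete_homogeneous\<close> is finite,
  so the sum does not degenerate to the default value 0.\<close>

lemma finite_exponent_vectors: "finite {rs :: nat list. length rs = n \<and> sum_list rs = r}"
  by (rule finite_subset[OF _ finite_lists_length_eq[of "{..r}" n]])
     (auto intro: member_le_sum_list)

lemma complete_homogeneous_0: "complete_homogeneous 0 zs = 1"
proof -
  have "{rs :: nat list. length rs = length zs \<and> sum_list rs = 0} = {replicate (length zs) 0}"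
    by (auto simp: sum_list_eq_0_iff intro!: replicate_eqI)
  then show ?thesis
    by (simp add: complete_homogeneous_def)
qed

end

theory Submission
  imports Defs
begin

text \<open>
  The generating function of the complete homogeneous polynomials at the given arguments is
  $H(t) = (1-t)/((1-t^p)(1-t^q))$, while the reversed cyclotomic polynomial
  $\sum_k a_{pq}(k) t^k = \prod_{(j,pq)=1} (1-\zeta_{pq}^j t)$ equals $(1-t^{pq}) H(t)$. The two
  therefore agree below degree $pq$. In that range each coefficient of
  $1/((1-t^p)(1-t^q))$ is 0 or 1, so the coefficients of $H$, being differences of two
  consecutive ones, lie in $\{-1,0,1\}$.
\<close>

section \<open>Roots of unity and the factorisation of \<open>1 - fps_X ^ n\<close>\<close>

lemma zeta_power: "zeta n ^ k = cis (2 * pi * real k / real n)"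
proof -
  have "zeta n = cis (2 * pi / real n)"
    by (simp add: zeta_def cis_conv_exp mult_ac)
  then show ?thesis
    by (simp add: DeMoivre mult_ac)
qed

lemma zeta_nonzero [simp]: "zeta n \<noteq> 0"
  by (simp add: zeta_def)

lemma zeta_power_self: "n > 0 \<Longrightarrow> zeta n ^ n = 1"
  by (simp add: zeta_power)

lemma zeta_mult_power: "p > 0 \<Longrightarrow> zeta (p * q) ^ (p * i) = zeta q ^ i"
  by (simp add: zeta_power mult.assoc)

lemma root_unity_eq_zeta_power:
  assumes "n > 0" "z ^ n = 1"
  obtains j where "j \<in> {1..n}" "z = zeta n ^ j"
proof -
  have "z \<in> (\<lambda>k. cis (2 * pi * real k / real n)) ` {..<n}"
    using bij_betw_roots_unity[OF assms(1)] assms(2) by (auto simp: bij_betw_def)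
  then obtain k where "k < n" "z = zeta n ^ k"
    by (auto simp: zeta_power)
  \<comment> \<open>The library indexes the roots from 0, the definitions here from 1, so
    \<open>k = 0\<close> is traded for \<open>n\<close>.\<close>
  then show thesis
    using that[of k] that[of n] assms(1) zeta_power_self by (cases "k = 0") auto
qed

text \<open>Both sides have degree at most \<open>n\<close> and agree at \<open>n + 1\<close>
  points: the \<open>n\<close>th roots of unity, where both vanish, and 0, where both equal
  1.\<close>

lemma prod_one_minus_zeta_poly:
  assumes "n > 0"
  shows "(\<Prod>j=1..n. [:1, - (zeta n ^ j):]) = 1 - monom 1 n"
proof (rule poly_eqI_degree)
  let ?A = "insert 0 {z::complex. z ^ n = 1}"
  have card: "card ?A = Suc n"
    using assms by (simp add: card_roots_unity_eq finite_roots_unity zero_power)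
  show "card ?A > degree (\<Prod>j=1..n. [:1, - (zeta n ^ j):])"
    unfolding card by (subst degree_prod_eq_sum_degree) auto
  have "degree (1 - monom 1 n :: complex poly) \<le> n"
    by (rule degree_diff_le) (simp_all add: degree_monom_le)
  then show "card ?A > degree (1 - monom 1 n :: complex poly)"
    unfolding card by simp
  fix z :: complex assume "z \<in> ?A"
  then consider "z = 0" | "z ^ n = 1" by auto
  then show "poly (\<Prod>j=1..n. [:1, - (zeta n ^ j):]) z = poly (1 - monom 1 n) z"
  proof cases
    case 1
    then show ?thesis using assms by (simp add: poly_prod poly_monom)
  next
    case 2
    \<comment> \<open>The factor vanishing at \<open>z\<close> is the one whose
      \<open>zeta n ^ j\<close> is the inverse of \<open>z\<close>.\<close>
    then have "inverse z ^ n = 1" by (simp add: power_inverse)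
    then obtain j where j: "j \<in> {1..n}" "inverse z = zeta n ^ j"
      using root_unity_eq_zeta_power assms by blast
    have "z \<noteq> 0" using 2 assms by (auto simp: zero_power)
    then have "1 - z * zeta n ^ j = 0" using j(2) by (simp flip: j(2))
    then show ?thesis
      using j(1) 2 by (auto simp: poly_prod poly_monom)
  qed
qed

abbreviation one_minus :: "'a :: comm_ring_1 \<Rightarrow> 'a fps" where
  "one_minus z \<equiv> 1 - fps_const z * fps_X"

lemma prod_one_minus_zeta:
  assumes "n > 0"
  shows "(\<Prod>j=1..n. one_minus (zeta n ^ j)) = 1 - fps_X ^ n"
proof -
  have "fps_of_poly (\<Prod>j=1..n. [:1, - (zeta n ^ j):]) = fps_of_poly (1 - monom 1 n)"
    using prod_one_minus_zeta_poly[OF assms] by simp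
  then show ?thesis
    by (simp add: fps_of_poly_prod fps_of_poly_diff fps_of_poly_monom' fps_of_poly_linear'
        flip: fps_const_neg)
qed

section \<open>The reversed cyclotomic polynomial\<close>

lemma reflect_poly_linear: "a \<noteq> 0 \<Longrightarrow> reflect_poly [:- a, 1:] = [:1, - a :: 'a :: comm_ring_1:]"
  by (simp add: reflect_poly_def)

lemma fps_of_reflect_cyclotomic:
  "fps_of_poly (reflect_poly (cyclotomic n)) =
     (\<Prod>j | 1 \<le> j \<and> j \<le> n \<and> coprime j n. one_minus (zeta n ^ j))"
  by (simp add: cyclotomic_def reflect_poly_prod reflect_poly_linear fps_of_poly_prod
      fps_of_poly_linear' flip: fps_const_neg)

lemma cyclotomic_coeff_eq_fps_nth:
  assumes "k \<le> totient n"
  shows "cyclotomic_coeff n k = fps_of_poly (reflect_poly (cyclotomic n)) $ k"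
  using assms by (simp add: cyclotomic_coeff_def coeff_reflect_poly degree_cyclotomic)

text \<open>Inclusion-exclusion on the factors of \<open>1 - fps_X ^ (p * q)\<close>: an index not
  coprime to \<open>p * q\<close> is a multiple of \<open>p\<close> or of \<open>q\<close>, and only
  \<open>p * q\<close> is both, contributing \<open>1 - fps_X\<close>.\<close>

lemma reflect_cyclotomic_prime_mult:
  assumes p: "prime p" and q: "prime q" and "p \<noteq> q"
  shows "fps_of_poly (reflect_poly (cyclotomic (p * q))) * (1 - fps_X ^ p) * (1 - fps_X ^ q) =
    (1 - fps_X ^ (p * q)) * (1 - fps_X)"
proof -
  let ?S = "{j. 1 \<le> j \<and> j \<le> p * q \<and> coprime j (p * q)}"
  let ?P = "(*) p ` {1..q}" and ?Q = "(*) q ` {1..p}"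
  let ?f = "\<lambda>j. one_minus (zeta (p * q) ^ j)"
  have pos: "p > 0" "q > 0" using p q by (auto simp: prime_gt_0_nat)
  have cop: "coprime p q" using assms by (simp add: primes_coprime)
  have P: "?P = {j. 1 \<le> j \<and> j \<le> p * q \<and> p dvd j}"
    using pos by (auto simp: dvd_def Suc_le_eq)
  have Q: "?Q = {j. 1 \<le> j \<and> j \<le> p * q \<and> q dvd j}"
    using pos by (auto simp: dvd_def Suc_le_eq mult.commute)
  have coprime_iff: "coprime j (p * q) \<longleftrightarrow> \<not> p dvd j \<and> \<not> q dvd j" for j
    using p q by (metis coprime_commute coprime_mult_right_iff prime_imp_coprime
        coprime_absorb_left not_prime_unit)
  have split: "{1..p * q} = ?S \<union> (?P \<union> ?Q)" "?S \<inter> (?P \<union> ?Q) = {}"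
    unfolding P Q by (auto simp: coprime_iff simp del: coprime_mult_right_iff)
  have inter: "?P \<inter> ?Q = {p * q}"
  proof -
    have "j = p * q" if "1 \<le> j" "j \<le> p * q" "p dvd j" "q dvd j" for j
      using that divides_mult[OF _ _ cop, of j] by (auto dest: dvd_imp_le)
    then show ?thesis using pos unfolding P Q by (auto simp: Suc_le_eq)
  qed
  \<comment> \<open>At multiples of \<open>p\<close> the powers of \<open>zeta (p * q)\<close> are
    powers of \<open>zeta q\<close>, hence the exponent \<open>q\<close>.\<close>
  have prodP: "prod ?f ?P = 1 - fps_X ^ q"
    using pos by (subst prod.reindex)
      (auto simp: inj_on_def zeta_mult_power prod_one_minus_zeta[unfolded One_nat_def])
  have prodQ: "prod ?f ?Q = 1 - fps_X ^ p"
    using pos zeta_mult_power[of q p] by (subst prod.reindex)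
      (auto simp: inj_on_def mult.commute[of p q] prod_one_minus_zeta[unfolded One_nat_def])
  have "(1 - fps_X ^ (p * q)) * (1 - fps_X) = prod ?f {1..p * q} * prod ?f (?P \<inter> ?Q)"
    using pos unfolding inter by (subst prod_one_minus_zeta) (simp_all add: zeta_power_self)
  also have "prod ?f {1..p * q} = prod ?f ?S * prod ?f (?P \<union> ?Q)"
    using split(2) by (subst split(1), intro prod.union_disjoint) auto
  also have "\<dots> * prod ?f (?P \<inter> ?Q) = prod ?f ?S * (prod ?f ?P * prod ?f ?Q)"
    by (subst prod.union_inter[symmetric]) (simp_all add: mult.assoc)
  finally show ?thesis
    unfolding prodP prodQ fps_of_reflect_cyclotomic by (simp only: mult_ac)
qed

section \<open>Generating function of the complete homogeneous polynomials\<close>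

lemma complete_homogeneous_Nil: "complete_homogeneous r [] = (if r = 0 then 1 else 0)"
proof -
  have "{rs :: nat list. length rs = 0 \<and> sum_list rs = r} = (if r = 0 then {[]} else {})"
    by auto
  then show ?thesis by (simp add: complete_homogeneous_def)
qed

text \<open>Splitting off the exponent of the first argument exhibits a Cauchy product with the
  geometric series in \<open>z\<close>.\<close>

lemma complete_homogeneous_Cons:
  "complete_homogeneous r (z # zs) = (\<Sum>i=0..r. z ^ i * complete_homogeneous (r - i) zs)"
proof -
  let ?V = "\<lambda>n r. {rs :: nat list. length rs = n \<and> sum_list rs = r}"
  let ?t = "\<lambda>rs. \<Prod>i<length zs. zs ! i ^ (rs ! i)"
  have "(\<Sum>i=0..r. z ^ i * complete_homogeneous (r - i) zs) =
      (\<Sum>(i, rs)\<in>Sigma {0..r} (\<lambda>i. ?V (length zs) (r - i)). z ^ i * ?t rs)"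
    by (simp add: complete_homogeneous_def sum_distrib_left sum.Sigma finite_exponent_vectors)
  also have "\<dots> = (\<Sum>rs\<in>?V (Suc (length zs)) r. \<Prod>i<Suc (length zs). (z # zs) ! i ^ (rs ! i))"
    by (rule sum.reindex_bij_witness[of _ "\<lambda>rs. (hd rs, tl rs)" "\<lambda>(i, rs). i # rs"])
       (auto simp: length_Suc_conv prod.lessThan_Suc_shift simp del: prod.lessThan_Suc)
  finally show ?thesis by (simp add: complete_homogeneous_def)
qed

lemma geometric_fps_mult: "Abs_fps (\<lambda>i. z ^ i) * one_minus z = 1"
proof (rule fps_ext)
  fix n
  show "(Abs_fps (\<lambda>i. z ^ i) * one_minus z) $ n = 1 $ n"
    by (cases n) (simp_all add: algebra_simps)
qed

lemma complete_homogeneous_generating_function: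
  "Abs_fps (\<lambda>r. complete_homogeneous r zs) * prod_list (map one_minus zs) = 1"
proof (induction zs)
  case Nil
  show ?case by (simp add: complete_homogeneous_Nil fps_eq_iff)
next
  case (Cons z zs)
  have "Abs_fps (\<lambda>r. complete_homogeneous r (z # zs)) =
      Abs_fps (\<lambda>i. z ^ i) * Abs_fps (\<lambda>r. complete_homogeneous r zs)"
    by (simp add: fps_eq_iff fps_mult_nth complete_homogeneous_Cons)
  then have "Abs_fps (\<lambda>r. complete_homogeneous r (z # zs)) * prod_list (map one_minus (z # zs)) =
      (Abs_fps (\<lambda>i. z ^ i) * one_minus z) *
      (Abs_fps (\<lambda>r. complete_homogeneous r zs) * prod_list (map one_minus zs))"
    by (simp only: list.map prod_list.Cons mult_ac)
  then show ?case by (simp only: geometric_fps_mult Cons.IH mult_1)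
qed

text \<open>The list omits the root 1; the extra \<open>1 - fps_X\<close> restores its
  factor.\<close>

lemma prod_list_one_minus_zeta:
  assumes "n > 0"
  shows "prod_list (map (\<lambda>j. one_minus (zeta n ^ j)) [1..<n]) * (1 - fps_X) = 1 - fps_X ^ n"
proof -
  have "prod_list (map (\<lambda>j. one_minus (zeta n ^ j)) [1..<n]) =
      (\<Prod>j\<in>{1..<n}. one_minus (zeta n ^ j))"
    using prod.distinct_set_conv_list[of "[1..<n]" "\<lambda>j. one_minus (zeta n ^ j)"] by simp
  moreover have "{1..n} = insert n {1..<n}" using assms by auto
  ultimately show ?thesis
    using prod_one_minus_zeta[OF assms] assms by (simp add: zeta_power_self mult.commute)
qed

section \<open>Counting sums of a multiple of \<open>p\<close> and a multiple of
  \<open>q\<close>\<close>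

definition multiples_fps :: "nat \<Rightarrow> complex fps" where
  "multiples_fps p = Abs_fps (\<lambda>n. if p dvd n then 1 else 0)"

lemma multiples_fps_mult: "p > 0 \<Longrightarrow> multiples_fps p * (1 - fps_X ^ p) = 1"
  by (auto simp: multiples_fps_def fps_eq_iff algebra_simps fps_X_power_mult_nth
      dvd_minus_self dest: dvd_imp_le)

text \<open>By the Chinese remainder theorem, a number below \<open>p * q\<close> has at most one
  representation as a multiple of \<open>p\<close> plus a multiple of \<open>q\<close>.\<close>

lemma multiples_fps_mult_nth:
  assumes "coprime p q" "n < p * q"
  shows "(multiples_fps p * multiples_fps q) $ n \<in> {0, 1}"
proof -
  let ?S = "{i \<in> {0..n}. p dvd i \<and> q dvd (n - i)}"
  \<comment> \<open>Ordering \<open>i\<close> and \<open>j\<close> keeps the natural-number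
    differences below from being truncated.\<close>
  have "i = j" if "i \<in> ?S" "j \<in> ?S" "i \<le> j" for i j
  proof -
    have dvd: "q dvd n - i" "q dvd n - j" "p dvd i" "p dvd j"
      using that(1,2) by blast+
    have "q dvd (n - i) - (n - j)" "p dvd j - i"
      by (fact dvd_diff_nat[OF dvd(1,2)] dvd_diff_nat[OF dvd(4,3)])+
    moreover have "(n - i) - (n - j) = j - i" using that by auto
    ultimately have "p * q dvd j - i" using assms(1) by (simp add: divides_mult)
    then show "i = j" using that assms(2) by (auto dest: dvd_imp_le)
  qed
  then have "i = j" if "i \<in> ?S" "j \<in> ?S" for i j
    using that linear[of i j] by blast
  then have "\<forall>i\<in>?S. \<forall>j\<in>?S. i = j" by blast
  then have "card ?S \<le> 1" by (simp add: card_le_Suc0_iff_eq)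
  moreover have "(multiples_fps p * multiples_fps q) $ n =
      (\<Sum>i=0..n. if p dvd i \<and> q dvd (n - i) then 1 else 0)"
    by (auto simp: multiples_fps_def fps_mult_nth intro!: sum.cong)
  then have "(multiples_fps p * multiples_fps q) $ n = of_nat (card ?S)"
    by (simp add: sum.If_cases Int_def)
  ultimately show ?thesis by (auto simp: le_Suc_eq)
qed

theorem theorem1p3:
  fixes p q :: nat
  assumes "prime p" and "prime q" and "p \<noteq> q"
  shows "\<forall>k \<in> {0..totient (p * q)}.
    cyclotomic_coeff (p * q) k =
      complete_homogeneous k
        (1 # map (\<lambda>j. zeta p ^ j) [1..<p] @ map (\<lambda>j. zeta q ^ j) [1..<q]) \<and>
    complete_homogeneous k
        (1 # map (\<lambda>j. zeta p ^ j) [1..<p] @ map (\<lambda>j. zeta q ^ j) [1..<q]) \<in> {-1, 0, 1}"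
proof
  fix k assume k: "k \<in> {0..totient (p * q)}"
  let ?zs = "1 # map (\<lambda>j. zeta p ^ j) [1..<p] @ map (\<lambda>j. zeta q ^ j) [1..<q]"
  define C where "C = fps_of_poly (reflect_poly (cyclotomic (p * q)))"
  define H where "H = Abs_fps (\<lambda>r. complete_homogeneous r ?zs)"
  define A where "A = prod_list (map one_minus ?zs)"
  define U V X :: "complex fps" where "U = 1 - fps_X ^ p" and "V = 1 - fps_X ^ q" and "X = 1 - fps_X"
  define R where "R = multiples_fps p * multiples_fps q"
  have pq: "p > 1" "q > 1" using assms by (simp_all only: prime_gt_1_nat)
  have cop: "coprime p q" using assms by (simp add: primes_coprime)
  have "X \<noteq> 0" by (auto simp: X_def fps_eq_iff intro!: exI[of _ 0])
  have "A = X * prod_list (map (\<lambda>j. one_minus (zeta p ^ j)) [1..<p]) *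
      prod_list (map (\<lambda>j. one_minus (zeta q ^ j)) [1..<q])"
    by (simp add: A_def X_def o_def mult.assoc)
  \<comment> \<open>The argument 1 occurs only once in \<open>?zs\<close>, so a second factor
    \<open>X\<close> is needed to complete both products.\<close>
  then have "A * X = (prod_list (map (\<lambda>j. one_minus (zeta p ^ j)) [1..<p]) * X) *
      (prod_list (map (\<lambda>j. one_minus (zeta q ^ j)) [1..<q]) * X)"
    by (simp only: mult_ac)
  then have AX: "A * X = U * V"
    using pq unfolding U_def V_def X_def by (simp only: prod_list_one_minus_zeta)
  have HA: "H * A = 1"
    unfolding H_def A_def by (rule complete_homogeneous_generating_function)
  have "C * A * X = (1 - fps_X ^ (p * q)) * X"
    using reflect_cyclotomic_prime_mult[OF assms] AX
    by (simp add: C_def U_def V_def X_def mult.assoc)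
  then have "C * A = 1 - fps_X ^ (p * q)" using \<open>X \<noteq> 0\<close> by simp
  then have "C = (1 - fps_X ^ (p * q)) * H"
    using HA by (metis mult.assoc mult.commute mult_1)
  \<comment> \<open>Below degree \<open>p * q\<close> the factor \<open>1 - fps_X ^ (p * q)\<close>
    leaves the coefficients of \<open>H\<close> unchanged.\<close>
  moreover have "k < p * q"
  proof -
    have "totient (p * q) < p * q" using pq by (intro totient_less) (metis less_1_mult)
    then show ?thesis using k by simp
  qed
  ultimately have "C $ k = H $ k"
    by (simp add: left_diff_distrib fps_X_power_mult_nth)
  then have coeff: "cyclotomic_coeff (p * q) k = complete_homogeneous k ?zs"
    using k by (simp add: cyclotomic_coeff_eq_fps_nth C_def H_def)
  have "R * (U * V) = 1"
    using multiples_fps_mult[of p] multiples_fps_mult[of q] pq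
    unfolding R_def U_def V_def by (metis mult.assoc mult.commute mult_1 less_trans zero_less_one)
  moreover have "H * (U * V) = X"
    using HA AX by (metis mult.assoc mult_1)
  \<comment> \<open>\<open>R\<close> is the inverse of \<open>U * V\<close>.\<close>
  ultimately have "H = X * R"
    by (metis mult.assoc mult.commute mult_1)
  then have "H = R - fps_X * R"
    by (simp add: X_def left_diff_distrib)
  \<comment> \<open>Multiplication by \<open>fps_X\<close> shifts the coefficients; the case split
    is needed because \<open>k - 1\<close> is 0 at \<open>k = 0\<close>.\<close>
  then have "H $ k = R $ k - (if k = 0 then 0 else R $ (k - 1))"
    by simp
  moreover have "R $ k \<in> {0, 1}" "R $ (k - 1) \<in> {0, 1}"
    using multiples_fps_mult_nth[OF cop] \<open>k < p * q\<close> unfolding R_def by auto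
  ultimately have "H $ k \<in> {-1, 0, 1}" by (auto split: if_splits)
  then show "cyclotomic_coeff (p * q) k = complete_homogeneous k ?zs \<and>
      complete_homogeneous k ?zs \<in> {-1, 0, 1}"
    using coeff by (simp add: H_def)
qed

end
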